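(* \[ \sum_{k = 0}^\infty {\frac{1}{{\alpha ^{12k} }}\left( {\frac{1}{{6k + 1}} - \frac{{3\beta ^2 }}{{6k + 2}} - \frac{{8\beta ^4 }}{{6k + 3}} - \frac{{3\beta ^6 }}{{6k + 4}} + \frac{{\beta ^8 }}{{6k + 5}}} \right)} = 0. \]
   Context: $\alpha=(1+\sqrt5)/2$ is the golden ratio and $\beta=-1/\alpha=(1-\sqrt5)/2$. *)

theory Defs
  imports Complex_Main
begin

definition golden :: real where
  "golden = (1 + sqrt 5) / 2"

definition golden_conj :: real where
  "golden_conj = - 1 / golden"

lemma golden_conj_eq: "golden_conj = (1 - sqrt 5) / 2"
proof -
  have pos: "1 + sqrt 5 > 0"
    by (simp add: add_pos_nonneg)
  have "(1 + sqrt 5) * (1 - sqrt 5) = - 4"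
    by (simp add: algebra_simps)
  with pos show ?thesis
    by (simp add: golden_conj_def golden_def field_simps)
qed

end

theory Submission
  imports Defs "HOL-Analysis.Complex_Transcendental"
begin

text \<open>
  Put \<open>q = \<beta>\<^sup>2\<close>. Multiplied by \<open>q\<close>, the series is the sum of \<open>c n * q ^ n / n\<close> over \<open>n \<ge> 1\<close>, where \<open>c\<close> is
  6-periodic with \<open>c n = 1 - 4 [2 dvd n] - 9 [3 dvd n] + 12 [6 dvd n]\<close>. Hence it equals
  \<open>- ln (1 - q) + 2 ln (1 - q\<^sup>2) + 3 ln (1 - q\<^sup>3) - 2 ln (1 - q\<^sup>6)\<close>, the logarithm of
  \<open>(1 - q)\<^sup>2 (1 + q + q\<^sup>2) / (1 - q + q\<^sup>2)\<^sup>2\<close>, and this quotient is 1 because \<open>q\<^sup>2 = 3 q - 1\<close>.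
\<close>

text \<open>The term at \<open>n = 0\<close> is \<open>1 / 0 = 0\<close>, so the logarithm series
  may start there.\<close>

lemma neg_ln_one_minus_sums:
  fixes x :: real
  assumes "\<bar>x\<bar> < 1"
  shows "(\<lambda>n. x ^ n / real n) sums (- ln (1 - x))"
  using sums_minus[OF ln_series'[of "- x"]] assms by simp

text \<open>Applied with \<open>d * m = 6\<close>: block \<open>k\<close> then covers the exponents
  from \<open>6 * k\<close> to \<open>6 * k + 5\<close>, so the series for different
  \<open>d\<close> can be combined termwise.\<close>

lemma neg_ln_one_minus_sums_group:
  fixes x :: real
  assumes "\<bar>x\<bar> < 1" "d > 0" "m > 0"
  shows "(\<lambda>k. \<Sum>i<m. x ^ (d * (m * k + i)) / real (m * k + i)) sums (- ln (1 - x ^ d))"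
proof -
  have "\<bar>x ^ d\<bar> < 1"
    using assms by (simp add: power_abs power_less_one_iff)
  from sums_group[OF neg_ln_one_minus_sums[OF this] \<open>m > 0\<close>]
  have "(\<lambda>k. \<Sum>n = k * m..<k * m + m. (x ^ d) ^ n / real n) sums (- ln (1 - x ^ d))" .
  moreover have "(\<Sum>n = k * m..<k * m + m. (x ^ d) ^ n / real n)
      = (\<Sum>i<m. x ^ (d * (m * k + i)) / real (m * k + i))" for k
    using sum.shift_bounds_nat_ivl[of "\<lambda>n. (x ^ d) ^ n / real n" 0 "k * m" m]
    by (simp add: power_mult ac_simps lessThan_atLeast0)
  ultimately show ?thesis
    by simp
qed

lemma ln_combination_sums:
  fixes q :: real
  assumes "\<bar>q\<bar> < 1"
  shows "(\<lambda>k. q * (q ^ (6 * k) *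
           (1 / (6 * real k + 1) - 3 * q / (6 * real k + 2) - 8 * q ^ 2 / (6 * real k + 3)
            - 3 * q ^ 3 / (6 * real k + 4) + q ^ 4 / (6 * real k + 5))))
         sums (- ln (1 - q) + 2 * ln (1 - q ^ 2) + 3 * ln (1 - q ^ 3) - 2 * ln (1 - q ^ 6))"
    (is "?f sums _")
proof -
  define S where "S d m k = (\<Sum>i<m. q ^ (d * (m * k + i)) / real (m * k + i))" for d m k
  have S: "S d m sums (- ln (1 - q ^ d))" if "d > 0" "m > 0" for d m
    unfolding S_def using neg_ln_one_minus_sums_group[OF assms that] .
  \<comment> \<open>The weights are 1, -4, -9, 12 divided by \<open>d\<close>, since
    \<open>(q ^ d) ^ j / j = d * q ^ n / n\<close> for \<open>n = d * j\<close>.\<close>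
  have "(\<lambda>k. S 1 6 k - 2 * S 2 3 k - 3 * S 3 2 k + 2 * S 6 1 k) sums
      (- ln (1 - q ^ 1) - 2 * (- ln (1 - q ^ 2)) - 3 * (- ln (1 - q ^ 3)) + 2 * (- ln (1 - q ^ 6)))"
    by (intro sums_add sums_diff sums_mult S) auto
  moreover have "S 1 6 k - 2 * S 2 3 k - 3 * S 3 2 k + 2 * S 6 1 k = ?f k" for k
  proof -
    define Q where "Q = q ^ (6 * k)"
    define x where "x = real k"
    have x: "x \<ge> 0"
      by (simp add: x_def)
    have S1: "S 1 6 k = Q * (1 / (6*x) + q / (6*x+1) + q^2 / (6*x+2) + q^3 / (6*x+3)
        + q^4 / (6*x+4) + q^5 / (6*x+5))"
      by (simp add: S_def Q_def x_def eval_nat_numeral distrib_left power_add ac_simps)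
    have S2: "S 2 3 k = Q * (1 / (3*x) + q^2 / (3*x+1) + q^4 / (3*x+2))"
      by (simp add: S_def Q_def x_def numeral_3_eq_3 distrib_left power_add mult.assoc [symmetric])
        (simp add: eval_nat_numeral ac_simps)
    have S3: "S 3 2 k = Q * (1 / (2*x) + q^3 / (2*x+1))"
      by (simp add: S_def Q_def x_def numeral_2_eq_2 distrib_left power_add mult.assoc [symmetric])
    have S6: "S 6 1 k = Q * (1 / x)"
      by (simp add: S_def Q_def x_def)
    \<comment> \<open>With all reciprocals expressed through \<open>A\<close>, a polynomial identity
      remains.\<close>
    define A where "A i = 1 / (6*x + real i)" for i
    have A: "1 / x = 6 * A 0" "1 / (2*x) = 3 * A 0" "1 / (3*x) = 2 * A 0" "1 / (6*x) = A 0"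
      by (simp_all add: A_def)
    have B: "c / (6*x + 1) = c * A 1" "c / (6*x + 2) = c * A 2" "c / (6*x + 3) = c * A 3"
      "c / (6*x + 4) = c * A 4" "c / (6*x + 5) = c * A 5"
      "c / (3*x + 1) = 2 * c * A 2" "c / (3*x + 2) = 2 * c * A 4" "c / (2*x + 1) = 3 * c * A 3" for c
      using x by (simp_all add: A_def divide_simps)
    \<comment> \<open>The multiples of \<open>A 0\<close> cancel, since \<open>1 - 4 - 9 + 12 = 0\<close>; for \<open>k = 0\<close> note \<open>A 0 = 1 / 0 = 0\<close>.\<close>
    show ?thesis
      unfolding S1 S2 S3 S6 Q_def [symmetric] x_def [symmetric] A B
      by algebra
  qed
  ultimately show ?thesis
    by simp
qed

lemma ln_combination_eq_0:
  fixes q :: real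
  assumes "0 < q" "q < 1" and q2: "q ^ 2 = 3 * q - 1"
  shows "- ln (1 - q) + 2 * ln (1 - q ^ 2) + 3 * ln (1 - q ^ 3) - 2 * ln (1 - q ^ 6) = 0"
proof -
  have q3: "q ^ 3 = 8 * q - 3"
    using q2 by algebra
  have pos: "1 - q > 0" "1 + q > 0"
    using assms by auto
  have e2: "1 - q ^ 2 = (1 - q) * (1 + q)"
    by algebra
  \<comment> \<open>The relation \<open>q2\<close> gives \<open>1 + q + q ^ 2 = 4 * q\<close> and,
    for \<open>e6\<close>, \<open>1 - q + q ^ 2 = 2 * q\<close>.\<close>
  have e3: "1 - q ^ 3 = (1 - q) * (4 * q)"
    using q2 by algebra
  have e6: "1 - q ^ 6 = (1 - q) * (4 * q) * ((1 + q) * (2 * q))"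
    using q2 by algebra
  have "q = (1 - q) ^ 2"
    using q2 by algebra
  then have "ln q = 2 * ln (1 - q)"
    using pos by (metis ln_realpow of_nat_numeral)
  moreover have "ln 4 = 2 * ln (2::real)" "ln 8 = 3 * ln (2::real)"
    using ln_realpow[of 2 2] ln_realpow[of 2 3] by simp_all
  ultimately show ?thesis
    unfolding e2 e3 e6 using pos assms(1) by (simp add: ln_mult)
qed

theorem theorem4p1:
  shows "(\<lambda>k::nat. 1 / golden ^ (12 * k) *
           (1 / (6 * real k + 1)
            - 3 * golden_conj ^ 2 / (6 * real k + 2)
            - 8 * golden_conj ^ 4 / (6 * real k + 3)
            - 3 * golden_conj ^ 6 / (6 * real k + 4)
            + golden_conj ^ 8 / (6 * real k + 5))) sums 0"
proof -
  define q where "q = golden_conj ^ 2"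
  have q_eq: "q = (3 - sqrt 5) / 2"
    by (simp add: q_def golden_conj_eq power2_eq_square field_simps)
  have "2 < sqrt 5" "sqrt 5 < 3"
    by (auto intro: real_less_rsqrt real_less_lsqrt)
  then have q: "0 < q" "q < 1"
    by (auto simp: q_eq)
  have q2: "q ^ 2 = 3 * q - 1"
    by (simp add: q_eq power2_eq_square field_simps)
  have powers: "golden_conj ^ 4 = q ^ 2" "golden_conj ^ 6 = q ^ 3" "golden_conj ^ 8 = q ^ 4"
    by (simp_all add: q_def flip: power_mult)
  have golden: "1 / golden ^ (12 * k) = q ^ (6 * k)" for k
    by (simp add: q_def golden_conj_def power_divide flip: power_mult)
  have "\<bar>q\<bar> < 1"
    using q by simp
  \<comment> \<open>Dividing by \<open>q\<close>, which is nonzero, removes the extra factor that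
    aligned exponents with denominators.\<close>
  from sums_mult[OF ln_combination_sums[OF this], of "1 / q"]
  show ?thesis
    unfolding golden powers q_def [symmetric] ln_combination_eq_0[OF q q2] using q by simp
qed

end
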